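(* Over any group $(A,\cdot)$ the following data are equivalent: (1) A group $G$ and a bijective $1$-cocycle $\pi\colon G\to A$. (2) A skew left brace structure over $A$.
   Context: A skew left brace is a group $A$ (written multiplicatively, $(a,b)\mapsto ab$, not necessarily abelian) with an additional group structure given by $(a,b)\mapsto a\circ b$ such that $a\circ(bc)=(a\circ b)a^{-1}(a\circ c)$ holds for all $a,b,c\in A$, where $a^{-1}$ denotes the inverse of $a$ with respect to the group structure $(a,b)\mapsto ab$. A skew left brace structure over a group $(A,\cdot)$ is a second group structure $\circ$ on the set $A$ making $A$, with $\cdot$ and $\circ$, a skew left brace. Let $A$ and $G$ be groups and assume that $G\times A\to A$, $(g,a)\mapsto g\cdot a$, is a left action of $G$ on $A$ by automorphisms. A bijective $1$-cocycle is a bijective map $\pi\colon G\to A$ such that $\pi(gh)=\pi(g)(g\cdot\pi(h))$ for all $g,h\in G$. *)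

theory Defs
  imports "HOL-Algebra.Group_Action" "HOL-Algebra.Bij"
begin

text \<open>
  The two group structures on one set are two monoid records with the same carrier:
  \<open>A\<close> is the multiplicative group, \<open>B\<close> carries the circle operation.
\<close>

locale skew_left_brace =
  A: group A + B: group B
  for A :: "'a monoid" and B :: "'a monoid" +
  assumes same_carrier: "carrier B = carrier A"
    and brace_law: "\<lbrakk>a \<in> carrier A; b \<in> carrier A; c \<in> carrier A\<rbrakk> \<Longrightarrow>
      a \<otimes>\<^bsub>B\<^esub> (b \<otimes>\<^bsub>A\<^esub> c) = (a \<otimes>\<^bsub>B\<^esub> b) \<otimes>\<^bsub>A\<^esub> inv\<^bsub>A\<^esub> a \<otimes>\<^bsub>A\<^esub> (a \<otimes>\<^bsub>B\<^esub> c)"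

text \<open>
  Records may differ in the values of the operation outside the carrier, so equality
  of group structures on a set is agreement on the carrier. The unit is determined
  by the multiplication.
\<close>

definition same_group_structure :: "'a monoid \<Rightarrow> 'a monoid \<Rightarrow> bool" where
  "same_group_structure B C \<longleftrightarrow> carrier B = carrier C \<and>
     (\<forall>a\<in>carrier B. \<forall>b\<in>carrier B. a \<otimes>\<^bsub>B\<^esub> b = a \<otimes>\<^bsub>C\<^esub> b)"

text \<open>
  As usual for \<open>group_action\<close>, each \<open>\<phi> g\<close> is extensional, i.e.\ undefined outside
  \<open>carrier A\<close>; hence the restriction in \<open>brace_action\<close> below.
\<close>

locale bijective_1_cocycle =
  G: group G + A: group A + group_action G "carrier A" \<phi>
  for G :: "'g monoid" and A :: "'a monoid" and \<phi> :: "'g \<Rightarrow> 'a \<Rightarrow> 'a" +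
  fixes \<pi> :: "'g \<Rightarrow> 'a"
  assumes by_automorphisms: "g \<in> carrier G \<Longrightarrow> \<phi> g \<in> auto A"
    and bijective: "bij_betw \<pi> (carrier G) (carrier A)"
    and cocycle: "\<lbrakk>g \<in> carrier G; h \<in> carrier G\<rbrakk> \<Longrightarrow>
      \<pi> (g \<otimes>\<^bsub>G\<^esub> h) = \<pi> g \<otimes>\<^bsub>A\<^esub> \<phi> g (\<pi> h)"

definition cocycle_iso ::
  "'a monoid \<Rightarrow> 'g monoid \<Rightarrow> ('g \<Rightarrow> 'a \<Rightarrow> 'a) \<Rightarrow> ('g \<Rightarrow> 'a) \<Rightarrow>
   'h monoid \<Rightarrow> ('h \<Rightarrow> 'a \<Rightarrow> 'a) \<Rightarrow> ('h \<Rightarrow> 'a) \<Rightarrow> ('g \<Rightarrow> 'h) \<Rightarrow> bool" where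
  "cocycle_iso A G \<phi> \<pi> H \<psi> \<rho> f \<longleftrightarrow> f \<in> iso G H \<and>
     (\<forall>g\<in>carrier G. \<rho> (f g) = \<pi> g) \<and>
     (\<forall>g\<in>carrier G. \<forall>a\<in>carrier A. \<psi> (f g) a = \<phi> g a)"

text \<open>
  The group structure of \<open>G\<close> transported to \<open>carrier A\<close> along the bijection \<open>\<pi>\<close>;
  conversely \<open>brace_action\<close> is the lambda map \<open>a \<mapsto> (b \<mapsto> a\<inverse> (a \<circ> b))\<close> of a
  skew left brace, for which the identity is a cocycle on the circle group.
\<close>

definition cocycle_group ::
  "'a monoid \<Rightarrow> 'g monoid \<Rightarrow> ('g \<Rightarrow> 'a) \<Rightarrow> 'a monoid" where
  "cocycle_group A G \<pi> =
     \<lparr>carrier = carrier A,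
      mult = (\<lambda>a b. \<pi> (inv_into (carrier G) \<pi> a \<otimes>\<^bsub>G\<^esub> inv_into (carrier G) \<pi> b)),
      one = \<pi> \<one>\<^bsub>G\<^esub>\<rparr>"

definition brace_action :: "'a monoid \<Rightarrow> 'a monoid \<Rightarrow> 'a \<Rightarrow> 'a \<Rightarrow> 'a" where
  "brace_action A B a = (\<lambda>b\<in>carrier A. inv\<^bsub>A\<^esub> a \<otimes>\<^bsub>A\<^esub> (a \<otimes>\<^bsub>B\<^esub> b))"

end

theory Submission
  imports Defs
begin

text \<open>
  A bijective cocycle \<open>\<pi>\<close> is a bijection of \<open>G\<close> with \<open>A\<close>, so it carries the group
  structure of \<open>G\<close> to an operation \<open>\<circ>\<close> on \<open>A\<close>. The cocycle identity then reads
  \<open>a \<circ> b = a (g \<cdot> b)\<close> for \<open>a = \<pi> g\<close>, that is, the action of \<open>g\<close> is the lambda map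
  \<open>\<lambda>\<^sub>a b = a\<inverse> (a \<circ> b)\<close>. The brace law says no more than that each \<open>\<lambda>\<^sub>a\<close> is
  multiplicative, which holds because \<open>G\<close> acts by automorphisms.

  Conversely, in a skew left brace associativity of \<open>\<circ>\<close> together with multiplicativity of
  \<open>\<lambda>\<^sub>a\<close> gives \<open>\<lambda>\<^sub>a (\<lambda>\<^sub>b c) = \<lambda>\<^sub>a\<^sub>\<circ>\<^sub>b c\<close>. Since the two units coincide, \<open>\<lambda>\<close> sends the unit
  to the identity, so it is an action of the circle group by automorphisms, and the identity
  map is a cocycle for it simply because \<open>a \<lambda>\<^sub>a b = a \<circ> b\<close>.

  The two constructions are mutually inverse up to the natural identifications. The action
  can be read off from \<open>\<pi>\<close> and \<open>\<circ>\<close>, by the lemma \<open>action_eq_lambda\<close>. An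
  isomorphism of cocycles is therefore just a group isomorphism that commutes with the maps
  to \<open>A\<close>. For cocycles \<open>\<pi>\<close> and \<open>\<rho>\<close> the only candidate is \<open>\<rho>\<inverse> \<pi>\<close>, and it is multiplicative
  exactly when the two circle operations agree.
\<close>

section \<open>From bijective cocycles to skew left braces\<close>

context bijective_1_cocycle
begin

lemma carrier_cocycle_group [simp]: "carrier (cocycle_group A G \<pi>) = carrier A"
  by (simp add: cocycle_group_def)

lemma \<pi>_closed [simp]: "g \<in> carrier G \<Longrightarrow> \<pi> g \<in> carrier A"
  using bijective by (auto simp: bij_betw_def)

lemma \<pi>_surj:
  assumes "a \<in> carrier A"
  obtains g where "g \<in> carrier G" "a = \<pi> g"
  using assms bijective by (auto simp: bij_betw_def)

lemma cocycle_group_mult: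
  assumes "g \<in> carrier G" "h \<in> carrier G"
  shows "\<pi> g \<otimes>\<^bsub>cocycle_group A G \<pi>\<^esub> \<pi> h = \<pi> (g \<otimes>\<^bsub>G\<^esub> h)"
  using assms bijective by (simp add: cocycle_group_def bij_betw_def inv_into_f_f)

lemma group_cocycle_group: "group (cocycle_group A G \<pi>)"
proof (rule groupI)
  show "\<one>\<^bsub>cocycle_group A G \<pi>\<^esub> \<in> carrier (cocycle_group A G \<pi>)"
    by (simp add: cocycle_group_def)
next
  fix a b
  assume "a \<in> carrier (cocycle_group A G \<pi>)" "b \<in> carrier (cocycle_group A G \<pi>)"
  then obtain g h where "g \<in> carrier G" "a = \<pi> g" "h \<in> carrier G" "b = \<pi> h"
    by (metis carrier_cocycle_group \<pi>_surj)
  then show "a \<otimes>\<^bsub>cocycle_group A G \<pi>\<^esub> b \<in> carrier (cocycle_group A G \<pi>)"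
    by (simp add: cocycle_group_mult)
next
  fix a b c
  assume "a \<in> carrier (cocycle_group A G \<pi>)" "b \<in> carrier (cocycle_group A G \<pi>)"
    "c \<in> carrier (cocycle_group A G \<pi>)"
  then obtain g h k where "g \<in> carrier G" "a = \<pi> g" "h \<in> carrier G" "b = \<pi> h"
    "k \<in> carrier G" "c = \<pi> k"
    by (metis carrier_cocycle_group \<pi>_surj)
  then show "a \<otimes>\<^bsub>cocycle_group A G \<pi>\<^esub> b \<otimes>\<^bsub>cocycle_group A G \<pi>\<^esub> c
      = a \<otimes>\<^bsub>cocycle_group A G \<pi>\<^esub> (b \<otimes>\<^bsub>cocycle_group A G \<pi>\<^esub> c)"
    by (simp add: cocycle_group_mult G.m_assoc)
next
  fix a assume "a \<in> carrier (cocycle_group A G \<pi>)"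
  then obtain g where g: "g \<in> carrier G" "a = \<pi> g"
    by (metis carrier_cocycle_group \<pi>_surj)
  have one: "\<one>\<^bsub>cocycle_group A G \<pi>\<^esub> = \<pi> \<one>\<^bsub>G\<^esub>"
    by (simp add: cocycle_group_def)
  show "\<one>\<^bsub>cocycle_group A G \<pi>\<^esub> \<otimes>\<^bsub>cocycle_group A G \<pi>\<^esub> a = a"
    using g by (simp add: one cocycle_group_mult)
  have "\<pi> (inv\<^bsub>G\<^esub> g) \<otimes>\<^bsub>cocycle_group A G \<pi>\<^esub> a = \<one>\<^bsub>cocycle_group A G \<pi>\<^esub>"
    using g by (simp add: one cocycle_group_mult)
  then show "\<exists>b\<in>carrier (cocycle_group A G \<pi>).
      b \<otimes>\<^bsub>cocycle_group A G \<pi>\<^esub> a = \<one>\<^bsub>cocycle_group A G \<pi>\<^esub>"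
    using g by (intro bexI) auto
qed

lemma iso_cocycle_group: "\<pi> \<in> iso G (cocycle_group A G \<pi>)"
  using bijective by (auto simp: iso_def hom_def cocycle_group_mult)

lemma action_closed [simp]: "\<lbrakk>g \<in> carrier G; a \<in> carrier A\<rbrakk> \<Longrightarrow> \<phi> g a \<in> carrier A"
  using by_automorphisms by (auto simp: auto_def hom_def)

lemma action_mult:
  "\<lbrakk>g \<in> carrier G; a \<in> carrier A; b \<in> carrier A\<rbrakk>
    \<Longrightarrow> \<phi> g (a \<otimes>\<^bsub>A\<^esub> b) = \<phi> g a \<otimes>\<^bsub>A\<^esub> \<phi> g b"
  using by_automorphisms by (auto simp: auto_def hom_def)

text \<open>
  This is the cocycle identity with its second argument parametrised by \<open>A\<close> instead of \<open>G\<close>,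
  which is possible because \<open>\<pi>\<close> is onto.
\<close>

lemma circle_eq_mult_action:
  assumes "g \<in> carrier G" "a \<in> carrier A"
  shows "\<pi> g \<otimes>\<^bsub>cocycle_group A G \<pi>\<^esub> a = \<pi> g \<otimes>\<^bsub>A\<^esub> \<phi> g a"
proof -
  obtain h where "h \<in> carrier G" "a = \<pi> h"
    using assms \<pi>_surj by blast
  then show ?thesis
    using assms by (simp add: cocycle_group_mult cocycle)
qed

text \<open>
  Solving the cocycle identity for the action shows that the action is no independent datum:
  it is determined by \<open>\<pi>\<close> and the circle operation.
\<close>

lemma action_eq_lambda:
  assumes "g \<in> carrier G" "a \<in> carrier A"
  shows "\<phi> g a = inv\<^bsub>A\<^esub> (\<pi> g) \<otimes>\<^bsub>A\<^esub> (\<pi> g \<otimes>\<^bsub>cocycle_group A G \<pi>\<^esub> a)"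
  using assms by (simp add: circle_eq_mult_action A.m_assoc [symmetric])

text \<open>
  With \<open>a = \<pi> g\<close>, both sides of the brace law equal \<open>a (g \<cdot> b) (g \<cdot> c)\<close>: the left side because
  \<open>g\<close> acts multiplicatively, the right side because \<open>a\<inverse>\<close> cancels the second factor \<open>a\<close>.
\<close>

lemma skew_left_brace_cocycle_group: "skew_left_brace A (cocycle_group A G \<pi>)"
proof (intro skew_left_brace.intro skew_left_brace_axioms.intro)
  show "group A" by (rule A.is_group)
  show "group (cocycle_group A G \<pi>)" by (rule group_cocycle_group)
  show "carrier (cocycle_group A G \<pi>) = carrier A" by simp
next
  fix a b c
  assume "a \<in> carrier A" and bc: "b \<in> carrier A" "c \<in> carrier A"
  then obtain g where g: "g \<in> carrier G" "a = \<pi> g"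
    using \<pi>_surj by blast
  have "inv\<^bsub>A\<^esub> a \<otimes>\<^bsub>A\<^esub> (a \<otimes>\<^bsub>A\<^esub> \<phi> g c) = \<phi> g c"
    using g bc by (simp add: A.m_assoc [symmetric])
  then show "a \<otimes>\<^bsub>cocycle_group A G \<pi>\<^esub> (b \<otimes>\<^bsub>A\<^esub> c)
      = (a \<otimes>\<^bsub>cocycle_group A G \<pi>\<^esub> b) \<otimes>\<^bsub>A\<^esub> inv\<^bsub>A\<^esub> a \<otimes>\<^bsub>A\<^esub> (a \<otimes>\<^bsub>cocycle_group A G \<pi>\<^esub> c)"
    using g bc by (simp add: circle_eq_mult_action action_mult A.m_assoc)
qed

lemma cocycle_iso_brace_cocycle:
  "cocycle_iso A G \<phi> \<pi>
    (cocycle_group A G \<pi>) (brace_action A (cocycle_group A G \<pi>)) id \<pi>"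
  by (simp add: cocycle_iso_def iso_cocycle_group brace_action_def action_eq_lambda)

end

section \<open>From skew left braces to bijective cocycles\<close>

context skew_left_brace
begin

lemma circle_closed [simp]:
  "\<lbrakk>a \<in> carrier A; b \<in> carrier A\<rbrakk> \<Longrightarrow> a \<otimes>\<^bsub>B\<^esub> b \<in> carrier A"
  using B.m_closed same_carrier by simp

text \<open>
  Write \<open>1\<close> for the unit of \<open>A\<close> and \<open>e\<close> for that of \<open>\<circ>\<close>. The brace law for \<open>e \<circ> (1 1)\<close> reads
  \<open>1 = 1 e\<inverse> 1\<close>.
\<close>

lemma same_unit: "\<one>\<^bsub>B\<^esub> = \<one>\<^bsub>A\<^esub>"
proof -
  have B1: "\<one>\<^bsub>B\<^esub> \<in> carrier A"
    using B.one_closed same_carrier by simp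
  have left: "\<one>\<^bsub>B\<^esub> \<otimes>\<^bsub>B\<^esub> \<one>\<^bsub>A\<^esub> = \<one>\<^bsub>A\<^esub>"
    by (simp add: same_carrier)
  have "\<one>\<^bsub>A\<^esub> = inv\<^bsub>A\<^esub> \<one>\<^bsub>B\<^esub>"
    using brace_law [OF B1 A.one_closed A.one_closed] B1 by (simp add: left)
  then show ?thesis
    using B1 by (metis A.inv_inv A.inv_one)
qed

lemma lambda_closed [simp]:
  "\<lbrakk>a \<in> carrier A; b \<in> carrier A\<rbrakk> \<Longrightarrow> brace_action A B a b \<in> carrier A"
  by (simp add: brace_action_def)

lemma mult_lambda:
  "\<lbrakk>a \<in> carrier A; b \<in> carrier A\<rbrakk> \<Longrightarrow> a \<otimes>\<^bsub>A\<^esub> brace_action A B a b = a \<otimes>\<^bsub>B\<^esub> b"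
  by (simp add: brace_action_def A.m_assoc [symmetric])

lemma lambda_hom: "a \<in> carrier A \<Longrightarrow> brace_action A B a \<in> hom A A"
  by (auto simp: hom_def brace_action_def brace_law A.m_assoc)

lemma lambda_one: "a \<in> carrier A \<Longrightarrow> brace_action A B \<one>\<^bsub>B\<^esub> a = a"
  using B.l_one [of a] by (simp add: brace_action_def same_carrier same_unit)

text \<open>
  After cancelling \<open>a \<circ> b\<close> on the left this is associativity of \<open>\<circ>\<close>: multiplying
  \<open>\<lambda>\<^sub>a (\<lambda>\<^sub>b c)\<close> by \<open>a \<circ> b = a \<lambda>\<^sub>a b\<close> and using that \<open>\<lambda>\<^sub>a\<close> is multiplicative gives
  \<open>a \<lambda>\<^sub>a (b \<lambda>\<^sub>b c) = a \<circ> (b \<circ> c)\<close>.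
\<close>

lemma lambda_circle:
  assumes a: "a \<in> carrier A" and b: "b \<in> carrier A" and c: "c \<in> carrier A"
  shows "brace_action A B (a \<otimes>\<^bsub>B\<^esub> b) c = brace_action A B a (brace_action A B b c)"
proof -
  let ?L = "brace_action A B"
  have "(a \<otimes>\<^bsub>B\<^esub> b) \<otimes>\<^bsub>A\<^esub> ?L a (?L b c) = a \<otimes>\<^bsub>A\<^esub> (?L a b \<otimes>\<^bsub>A\<^esub> ?L a (?L b c))"
    using a b c by (simp add: A.m_assoc flip: mult_lambda)
  also have "\<dots> = a \<otimes>\<^bsub>A\<^esub> ?L a (b \<otimes>\<^bsub>A\<^esub> ?L b c)"
    using a b c lambda_hom [OF a] by (simp add: hom_def)
  also have "\<dots> = a \<otimes>\<^bsub>B\<^esub> (b \<otimes>\<^bsub>B\<^esub> c)"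
    using a b c by (simp add: mult_lambda)
  also have "\<dots> = (a \<otimes>\<^bsub>B\<^esub> b) \<otimes>\<^bsub>B\<^esub> c"
    using a b c B.m_assoc same_carrier by simp
  also have "\<dots> = (a \<otimes>\<^bsub>B\<^esub> b) \<otimes>\<^bsub>A\<^esub> ?L (a \<otimes>\<^bsub>B\<^esub> b) c"
    using a b c by (simp add: mult_lambda)
  finally show ?thesis
    using a b c by simp
qed

text \<open>
  The preceding two lemmas make \<open>\<lambda>\<close> of the circle inverse of \<open>a\<close> a two-sided inverse
  of \<open>\<lambda>\<^sub>a\<close>.
\<close>

lemma lambda_Bij:
  assumes "a \<in> carrier A"
  shows "brace_action A B a \<in> Bij (carrier A)"
proof -
  have inv: "inv\<^bsub>B\<^esub> a \<in> carrier A"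
    using B.inv_closed assms same_carrier by simp
  have "inv\<^bsub>B\<^esub> a \<otimes>\<^bsub>B\<^esub> a = \<one>\<^bsub>B\<^esub>" "a \<otimes>\<^bsub>B\<^esub> inv\<^bsub>B\<^esub> a = \<one>\<^bsub>B\<^esub>"
    using assms same_carrier by simp_all
  then have "bij_betw (brace_action A B a) (carrier A) (carrier A)"
    using assms inv
    by (intro bij_betw_byWitness [where f' = "brace_action A B (inv\<^bsub>B\<^esub> a)"])
      (auto simp: lambda_one simp flip: lambda_circle)
  then show ?thesis
    by (simp add: Bij_def brace_action_def)
qed

lemma lambda_group_hom: "group_hom B (BijGroup (carrier A)) (brace_action A B)"
proof (intro group_hom.intro group_hom_axioms.intro)
  show "group B" by (rule B.is_group)
  show "group (BijGroup (carrier A))" by (rule group_BijGroup)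
  have "brace_action A B (a \<otimes>\<^bsub>B\<^esub> b)
      = compose (carrier A) (brace_action A B a) (brace_action A B b)"
    if "a \<in> carrier A" "b \<in> carrier A" for a b
  proof (rule extensionalityI)
    show "brace_action A B (a \<otimes>\<^bsub>B\<^esub> b) \<in> extensional (carrier A)"
      by (simp add: brace_action_def)
  qed (use that in \<open>simp_all add: compose_eq lambda_circle\<close>)
  then show "brace_action A B \<in> hom B (BijGroup (carrier A))"
    by (auto simp: hom_def BijGroup_def same_carrier lambda_Bij)
qed

lemma bijective_1_cocycle_id: "bijective_1_cocycle B A (brace_action A B) id"
proof (intro bijective_1_cocycle.intro bijective_1_cocycle_axioms.intro group_action.intro)
  show "group B" by (rule B.is_group)
  show "group A" by (rule A.is_group)
  show "group_hom B (BijGroup (carrier A)) (brace_action A B)" by (rule lambda_group_hom)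
  show "bij_betw id (carrier B) (carrier A)" by (simp add: same_carrier)
qed (simp_all add: auto_def lambda_hom lambda_Bij same_carrier mult_lambda)

lemma same_group_structure_cocycle_group_id:
  "same_group_structure (cocycle_group A B id) B"
  by (simp add: same_group_structure_def cocycle_group_def same_carrier inv_into_f_f [of id, simplified])

end

section \<open>Isomorphism of cocycles and equality of braces\<close>

text \<open>
  The map \<open>\<rho>\<inverse> \<pi>\<close> is an isomorphism because it goes through the common circle group. It
  respects the actions because both are computed from that group by the same formula.
\<close>

lemma cocycle_iso_if_same_group_structure:
  assumes G: "bijective_1_cocycle G A \<phi> \<pi>" and H: "bijective_1_cocycle H A \<psi> \<rho>"
    and same: "same_group_structure (cocycle_group A G \<pi>) (cocycle_group A H \<rho>)"
  shows "cocycle_iso A G \<phi> \<pi> H \<psi> \<rho> (inv_into (carrier H) \<rho> \<circ> \<pi>)"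
proof -
  interpret G: bijective_1_cocycle G A \<phi> \<pi> by (rule G)
  interpret H: bijective_1_cocycle H A \<psi> \<rho> by (rule H)
  let ?f = "inv_into (carrier H) \<rho> \<circ> \<pi>"
  have circle: "a \<otimes>\<^bsub>cocycle_group A G \<pi>\<^esub> b = a \<otimes>\<^bsub>cocycle_group A H \<rho>\<^esub> b"
    if "a \<in> carrier A" "b \<in> carrier A" for a b
    using same that by (simp add: same_group_structure_def)
  then have "\<pi> \<in> iso G (cocycle_group A H \<rho>)"
    using G.iso_cocycle_group by (auto simp: iso_def hom_def)
  moreover have "inv_into (carrier H) \<rho> \<in> iso (cocycle_group A H \<rho>) H"
    using H.G.iso_set_sym [OF H.iso_cocycle_group] .
  ultimately have iso: "?f \<in> iso G H"
    by (rule iso_set_trans)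
  have f_closed: "?f g \<in> carrier H" if "g \<in> carrier G" for g
    using iso that by (auto simp: iso_def hom_def)
  have \<rho>_f: "\<rho> (?f g) = \<pi> g" if "g \<in> carrier G" for g
    using H.bijective that by (simp add: bij_betw_def f_inv_into_f)
  have "\<psi> (?f g) a = \<phi> g a" if "g \<in> carrier G" "a \<in> carrier A" for g a
    unfolding H.action_eq_lambda [OF f_closed [OF that(1)] that(2)] \<rho>_f [OF that(1)]
    using that by (simp add: G.action_eq_lambda circle)
  with iso \<rho>_f show ?thesis
    by (simp add: cocycle_iso_def)
qed

lemma same_group_structure_if_cocycle_iso:
  assumes G: "bijective_1_cocycle G A \<phi> \<pi>" and H: "bijective_1_cocycle H A \<psi> \<rho>"
    and f: "cocycle_iso A G \<phi> \<pi> H \<psi> \<rho> f"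
  shows "same_group_structure (cocycle_group A G \<pi>) (cocycle_group A H \<rho>)"
proof -
  interpret G: bijective_1_cocycle G A \<phi> \<pi> by (rule G)
  interpret H: bijective_1_cocycle H A \<psi> \<rho> by (rule H)
  have f_hom: "f \<in> hom G H" and \<rho>_f: "\<And>g. g \<in> carrier G \<Longrightarrow> \<rho> (f g) = \<pi> g"
    using f by (auto simp: cocycle_iso_def iso_def)
  have "a \<otimes>\<^bsub>cocycle_group A G \<pi>\<^esub> b = a \<otimes>\<^bsub>cocycle_group A H \<rho>\<^esub> b"
    if ab: "a \<in> carrier A" "b \<in> carrier A" for a b
  proof -
    obtain g h where g: "g \<in> carrier G" "a = \<pi> g" and h: "h \<in> carrier G" "b = \<pi> h"
      using ab G.\<pi>_surj by metis
    have "a \<otimes>\<^bsub>cocycle_group A G \<pi>\<^esub> b = \<rho> (f (g \<otimes>\<^bsub>G\<^esub> h))"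
      using g h by (simp add: G.cocycle_group_mult \<rho>_f)
    also have "\<dots> = \<rho> (f g) \<otimes>\<^bsub>cocycle_group A H \<rho>\<^esub> \<rho> (f h)"
      using g h f_hom by (simp add: hom_mult hom_in_carrier H.cocycle_group_mult)
    finally show ?thesis
      using g h by (simp add: \<rho>_f)
  qed
  then show ?thesis
    by (simp add: same_group_structure_def)
qed

section \<open>Equivalence of the two kinds of data\<close>

theorem proposition1p11:
  fixes A :: "'a monoid"
  assumes "group A"
  shows
    "(\<forall>(G :: 'g monoid) \<phi> \<pi>. bijective_1_cocycle G A \<phi> \<pi> \<longrightarrow>
        skew_left_brace A (cocycle_group A G \<pi>))
   \<and> (\<forall>B. skew_left_brace A B \<longrightarrow>
        bijective_1_cocycle B A (brace_action A B) id)
   \<and> (\<forall>B. skew_left_brace A B \<longrightarrow>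
        same_group_structure (cocycle_group A B id) B)
   \<and> (\<forall>(G :: 'g monoid) \<phi> \<pi>. bijective_1_cocycle G A \<phi> \<pi> \<longrightarrow>
        cocycle_iso A G \<phi> \<pi>
          (cocycle_group A G \<pi>) (brace_action A (cocycle_group A G \<pi>)) id \<pi>)
   \<and> (\<forall>(G :: 'g monoid) \<phi> \<pi> (H :: 'h monoid) \<psi> \<rho>.
        bijective_1_cocycle G A \<phi> \<pi> \<and> bijective_1_cocycle H A \<psi> \<rho> \<longrightarrow>
        (same_group_structure (cocycle_group A G \<pi>) (cocycle_group A H \<rho>) \<longleftrightarrow>
         (\<exists>f. cocycle_iso A G \<phi> \<pi> H \<psi> \<rho> f)))"
  by (intro conjI allI impI iffI)
    (blast intro: bijective_1_cocycle.skew_left_brace_cocycle_group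
      skew_left_brace.bijective_1_cocycle_id
      skew_left_brace.same_group_structure_cocycle_group_id
      bijective_1_cocycle.cocycle_iso_brace_cocycle
      cocycle_iso_if_same_group_structure same_group_structure_if_cocycle_iso)+

end
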